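(* There exists a transcendental meromorphic function $F:\mathbb{C}\to\widehat{\mathbb{C}}$ without fixed points (i.e. there is no $z\in\mathbb{C}$ with $F(z)=z$) and without invariant Baker domains.
   Context: $\widehat{\mathbb{C}}=\mathbb{C}\cup\{\infty\}$. A meromorphic function on $\mathbb{C}$ is transcendental if it is not rational. For a transcendental meromorphic function $F:\mathbb{C}\to\widehat{\mathbb{C}}$, with iterates $F^k$, the Fatou set of $F$ is the set of all points having a neighborhood in which all iterates $F^k$, $k\in\mathbb{N}$, are defined and form a normal family (with respect to the spherical metric). A component $U$ of the Fatou set is called invariant if $F(U)\subset U$. An invariant Baker domain of $F$ is an invariant component $U$ of the Fatou set of $F$ in which $F^k(z)\to\infty$ as $k\to\infty$ (for $z\in U$). *)

theory Defs
  imports "HOL-Complex_Analysis.Complex_Analysis" "HOL-Computational_Algebra.Polynomial"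
begin

text \<open>
  The Riemann sphere, with \<open>None\<close> as the point at infinity. This is the representation that
  \<^const>\<open>Alexandroff_compactification\<close> uses.
\<close>

type_synonym riemann_sphere = "complex option"

text \<open>Inverse stereographic projection onto the unit sphere of \<open>complex \<times> real\<close>.\<close>

fun to_unit_sphere :: "riemann_sphere \<Rightarrow> complex \<times> real" where
  "to_unit_sphere None = (0, 1)"
| "to_unit_sphere (Some z) =
     (of_real (2 / ((cmod z)\<^sup>2 + 1)) * z, ((cmod z)\<^sup>2 - 1) / ((cmod z)\<^sup>2 + 1))"

text \<open>The spherical metric is the great-circle distance on that unit sphere.\<close>

definition spherical_dist :: "riemann_sphere \<Rightarrow> riemann_sphere \<Rightarrow> real" where
  "spherical_dist p q = arccos (to_unit_sphere p \<bullet> to_unit_sphere q)"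

text \<open>
  The library's \<open>nicely_meromorphic_on\<close> gives a function the value \<open>0\<close> at its poles and makes it
  continuous elsewhere. So \<open>F\<close> is meromorphic as a map into the sphere iff replacing \<open>\<infinity>\<close> by \<open>0\<close>
  yields a nicely meromorphic function whose poles are exactly the points that \<open>F\<close> sends to \<open>\<infinity>\<close>.
  In particular \<open>F\<close> cannot be the constant \<open>\<infinity>\<close>.
\<close>

definition finite_part :: "(complex \<Rightarrow> riemann_sphere) \<Rightarrow> complex \<Rightarrow> complex" where
  "finite_part F z = (case F z of None \<Rightarrow> 0 | Some w \<Rightarrow> w)"

definition meromorphic_map :: "(complex \<Rightarrow> riemann_sphere) \<Rightarrow> bool" where
  "meromorphic_map F \<longleftrightarrow>
     finite_part F nicely_meromorphic_on UNIV \<and> (\<forall>z. F z = None \<longleftrightarrow> is_pole (finite_part F) z)"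

text \<open>
  Only used for meromorphic maps: these are continuous into the sphere, so agreeing with a quotient
  of polynomials off the finitely many zeros of the denominator determines them.
\<close>

definition rational_map :: "(complex \<Rightarrow> riemann_sphere) \<Rightarrow> bool" where
  "rational_map F \<longleftrightarrow>
     (\<exists>p q. q \<noteq> 0 \<and> (\<forall>z. poly q z \<noteq> 0 \<longrightarrow> F z = Some (poly p z / poly q z)))"

definition transcendental_meromorphic :: "(complex \<Rightarrow> riemann_sphere) \<Rightarrow> bool" where
  "transcendental_meromorphic F \<longleftrightarrow> meromorphic_map F \<and> \<not> rational_map F"

text \<open>
  \<open>F\<close> is not defined at \<open>\<infinity>\<close>. An orbit that reaches \<open>\<infinity>\<close> at step \<open>k\<close> has a \<open>k\<close>-th iterate
  (with value \<open>\<infinity>\<close>) but no later ones. The recursion returns \<open>None\<close> for the later ones too,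
  so \<open>iterate_defined\<close> records which values are meaningful.
\<close>

primrec iterate :: "(complex \<Rightarrow> riemann_sphere) \<Rightarrow> nat \<Rightarrow> complex \<Rightarrow> riemann_sphere" where
  "iterate F 0 z = Some z"
| "iterate F (Suc k) z = Option.bind (iterate F k z) F"

definition iterate_defined :: "(complex \<Rightarrow> riemann_sphere) \<Rightarrow> nat \<Rightarrow> complex \<Rightarrow> bool" where
  "iterate_defined F k z \<longleftrightarrow> (\<forall>j<k. iterate F j z \<noteq> None)"

text \<open>The limit \<open>g\<close> takes values in the sphere, so locally uniform convergence to \<open>\<infinity>\<close> is allowed.\<close>

definition normal_family_on :: "complex set \<Rightarrow> (complex \<Rightarrow> riemann_sphere) set \<Rightarrow> bool" where
  "normal_family_on U \<F> \<longleftrightarrow>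
     (\<forall>s :: nat \<Rightarrow> complex \<Rightarrow> riemann_sphere. range s \<subseteq> \<F> \<longrightarrow>
        (\<exists>(r :: nat \<Rightarrow> nat) g. strict_mono r \<and>
           (\<forall>K. compact K \<and> K \<subseteq> U \<longrightarrow>
              (\<forall>e>0. \<forall>\<^sub>F n in sequentially. \<forall>z\<in>K. spherical_dist (s (r n) z) (g z) < e))))"

definition fatou_set :: "(complex \<Rightarrow> riemann_sphere) \<Rightarrow> complex set" where
  "fatou_set F =
     {z. \<exists>U. open U \<and> z \<in> U \<and> (\<forall>k. \<forall>w\<in>U. iterate_defined F k w) \<and>
           normal_family_on U (range (iterate F))}"

definition invariant_component :: "(complex \<Rightarrow> riemann_sphere) \<Rightarrow> complex set \<Rightarrow> bool" where
  "invariant_component F U \<longleftrightarrow> U \<in> components (fatou_set F) \<and> F ` U \<subseteq> Some ` U"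

definition invariant_baker_domain :: "(complex \<Rightarrow> riemann_sphere) \<Rightarrow> complex set \<Rightarrow> bool" where
  "invariant_baker_domain F U \<longleftrightarrow>
     invariant_component F U \<and>
     (\<forall>z\<in>U. (\<lambda>k. spherical_dist (iterate F k z) None) \<longlonglongrightarrow> 0)"

end

theory Submission
  imports Defs
begin

text \<open>
  For entire \<open>g\<close> the map \<open>z + 1 / g z\<close> has no fixed points, and its poles are the zeros of \<open>g\<close>. We
  take \<open>g\<close> generic for locally uniform convergence. For an open set \<open>B\<close>, the functions for which
  some orbit starting in \<open>B\<close> hits a pole form an open set, up to a harmless stability requirement.
  If \<open>B\<close> contains a point with an unbounded orbit that never hits a pole, then \<open>g\<close> lies in
  the closure of this set: multiplying \<open>g\<close> by \<open>1 - (w / a) ^ m * p w\<close>, where \<open>a\<close> is the first far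
  point of the orbit, \<open>m\<close> is large and the polynomial \<open>p\<close> vanishes at the earlier points with
  \<open>p a = 1\<close>, hardly changes \<open>g\<close> on a large disc but makes the orbit end in the pole \<open>a\<close>. A generic
  \<open>g\<close> avoids the boundaries of these open sets for all \<open>B\<close> in a countable basis, so some orbit
  from \<open>B\<close> does hit a pole. Hence no open subset of the Fatou set escapes to infinity. In the same
  way a generic \<open>g\<close> has infinitely many zeros, so the map is not rational.
\<close>

section \<open>Locally uniform convergence on the plane\<close>

text \<open>One parameter \<open>e\<close> serves as the accuracy and, through the radius
  \<open>1 / e\<close>, as the size of the disc on which it is demanded. Smaller \<open>e\<close> is
  stronger on both counts.\<close>

definition near :: "real \<Rightarrow> (complex \<Rightarrow> complex) \<Rightarrow> (complex \<Rightarrow> complex) \<Rightarrow> bool" where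
  "near e g f \<longleftrightarrow> (\<forall>z. norm z * e \<le> 1 \<longrightarrow> norm (f z - g z) < e)"

text \<open>The neighbourhood filter of \<open>g\<close> for locally uniform convergence, which
  makes \<open>eventually\<close> and \<open>uniform_limit\<close> available. It ranges over all
  functions, so holomorphy of the nearby \<open>f\<close> is stated separately.\<close>

definition compact_nhds :: "(complex \<Rightarrow> complex) \<Rightarrow> (complex \<Rightarrow> complex) filter" where
  "compact_nhds g = (INF e\<in>{0<..}. principal {f. near e g f})"

lemma near_refl: "0 < e \<Longrightarrow> near e g g"
  by (simp add: near_def)

lemma near_mono: "near d g f \<Longrightarrow> d \<le> e \<Longrightarrow> near e g f"
  unfolding near_def by (meson less_le_trans mult_left_mono norm_ge_zero order_trans)

text \<open>The disc of radius \<open>1 / (d + e)\<close> lies in the discs of radius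
  \<open>1 / d\<close> and \<open>1 / e\<close>, so the two errors simply add there.\<close>

lemma near_triangle:
  assumes "near d f g" "near e g h" "0 < d" "0 < e"
  shows "near (d + e) f h"
  unfolding near_def
proof (intro allI impI)
  fix z :: complex assume z: "norm z * (d + e) \<le> 1"
  have "0 \<le> norm z * d" "0 \<le> norm z * e"
    using assms by auto
  then have "norm z * d \<le> 1" "norm z * e \<le> 1"
    using z by (auto simp: algebra_simps)
  then have "norm (g z - f z) < d" "norm (h z - g z) < e"
    using assms by (auto simp: near_def)
  then show "norm (h z - f z) < d + e"
    using norm_triangle_ineq[of "h z - g z" "g z - f z"] by simp
qed

lemma eventually_compact_nhds:
  "eventually P (compact_nhds g) \<longleftrightarrow> (\<exists>e>0. \<forall>f. near e g f \<longrightarrow> P f)"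
proof -
  have "eventually P (compact_nhds g) \<longleftrightarrow>
          (\<exists>e\<in>{0<..}. eventually P (principal {f. near e g f}))"
    unfolding compact_nhds_def
  proof (rule eventually_INF_base)
    fix a b :: real assume "a \<in> {0<..}" "b \<in> {0<..}"
    then show "\<exists>x\<in>{0<..}. principal {f. near x g f}
        \<le> inf (principal {f. near a g f}) (principal {f. near b g f})"
      by (intro bexI[of _ "min a b"]) (auto intro: near_mono)
  qed auto
  then show ?thesis
    by (auto simp: eventually_principal)
qed

lemma uniform_limit_compact_nhds:
  assumes "bounded X"
  shows "uniform_limit X (\<lambda>f. f) g (compact_nhds g)"
proof (rule uniform_limitI)
  fix e :: real assume e: "0 < e"
  obtain B where B: "0 < B" "\<And>x. x \<in> X \<Longrightarrow> norm x \<le> B"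
    using assms unfolding bounded_pos by auto
  \<comment> \<open>The bound \<open>1 / B\<close> makes the tested disc contain \<open>X\<close>;
    the bound \<open>e\<close> gives the accuracy.\<close>
  have "\<forall>x\<in>X. dist (f x) (g x) < e" if "near (min e (1 / B)) g f" for f
  proof
    fix x assume "x \<in> X"
    then have "norm x * min e (1 / B) \<le> B * (1 / B)"
      using B e by (intro mult_mono) auto
    then show "dist (f x) (g x) < e"
      using that B by (auto simp: near_def dist_norm)
  qed
  then show "\<forall>\<^sub>F f in compact_nhds g. \<forall>x\<in>X. dist (f x) (g x) < e"
    unfolding eventually_compact_nhds using e B by (intro exI[of _ "min e (1 / B)"]) auto
qed

section \<open>Baire category for entire functions\<close>

text \<open>The radii decay geometrically, so the steps telescope and the sequence is uniformly
  Cauchy on every disc.\<close>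

lemma holomorphic_limit_of_near_sequence:
  fixes g :: "nat \<Rightarrow> complex \<Rightarrow> complex"
  assumes hol: "\<And>n. g n holomorphic_on UNIV"
    and pos: "\<And>n. 0 < e n"
    and step: "\<And>n. near (e n / 4) (g n) (g (Suc n))"
    and small: "\<And>n. e (Suc n) \<le> e n / 8"
  obtains h where "h holomorphic_on UNIV" "\<And>n. near (e n) (g n) h"
proof -
  \<comment> \<open>The induction closes because \<open>e n / 4 + e (Suc n) / 2\<close> is at most
    \<open>5 / 16 * e n\<close>. Stopping at \<open>e n / 2\<close> leaves room for the strict
    inequality after passing to the limit.\<close>
  have tail: "near (e n / 2) (g n) (g (n + k))" for n k
  proof (induction k arbitrary: n)
    case 0
    show ?case using pos[of n] by (simp add: near_refl)
  next
    case (Suc k)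
    have "near (e n / 4 + e (Suc n) / 2) (g n) (g (Suc n + k))"
      using Suc.IH[of "Suc n"] step[of n] pos[of n] pos[of "Suc n"] by (intro near_triangle) auto
    then show ?case
      using small[of n] pos[of n] by (auto intro: near_mono)
  qed
  have e_le: "e n \<le> e 0 * (1 / 8) ^ n" for n
  proof (induction n)
    case (Suc n)
    show ?case using small[of n] Suc by simp
  qed simp
  have "(\<lambda>n. e 0 * (1 / 8) ^ n) \<longlonglongrightarrow> e 0 * 0"
    by (intro tendsto_intros LIMSEQ_power_zero) auto
  then have e0: "e \<longlonglongrightarrow> 0"
    by (intro tendsto_sandwich[of "\<lambda>n. 0" e _ "\<lambda>n. e 0 * (1 / 8) ^ n"])
       (use pos e_le in \<open>auto intro!: always_eventually less_imp_le\<close>)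
  have Cau: "uniformly_Cauchy_on (cball 0 R) g" for R
  proof (rule uniformly_Cauchy_onI')
    fix d :: real assume "0 < d"
    \<comment> \<open>The second bound makes the disc tested at stage \<open>m\<close> contain
      \<open>cball 0 R\<close>; adding 1 keeps the denominator positive.\<close>
    then have "0 < min d (1 / (\<bar>R\<bar> + 1))" by auto
    then obtain N where N: "e n < min d (1 / (\<bar>R\<bar> + 1))" if "n \<ge> N" for n
      using order_tendstoD(2)[OF e0] unfolding eventually_sequentially by blast
    have "dist (g m x) (g n x) < d" if "x \<in> cball 0 R" "m \<ge> N" "n > m" for x m n
    proof -
      obtain k where k: "n = m + k"
        using \<open>n > m\<close> less_imp_add_positive by metis
      have "norm x * (e m / 2) \<le> (\<bar>R\<bar> + 1) * (1 / (\<bar>R\<bar> + 1))"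
        using that(1) N[OF that(2)] pos[of m] by (intro mult_mono) auto
      then have "norm x * (e m / 2) \<le> 1" by (simp split: if_splits)
      then have "norm (g n x - g m x) < e m / 2"
        using tail[of m k] unfolding near_def k by blast
      then show ?thesis
        using N[OF that(2)] pos[of m] by (auto simp: dist_norm norm_minus_commute)
    qed
    then show "\<exists>M. \<forall>x\<in>cball 0 R. \<forall>m\<ge>M. \<forall>n>m. dist (g m x) (g n x) < d" by blast
  qed
  define h where "h z = lim (\<lambda>n. g n z)" for z
  have unif: "uniform_limit (cball 0 R) g h sequentially" for R
    using Cauchy_uniformly_convergent[OF Cau[of R]]
    unfolding uniformly_convergent_uniform_limit_iff h_def .
  have "h holomorphic_on UNIV"
  proof (rule holomorphic_uniform_sequence)
    fix x :: complex
    have "cball x 1 \<subseteq> cball 0 (norm x + 1)"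
      by (simp add: cball_subset_cball_iff dist_norm)
    then have "uniform_limit (cball x 1) g h sequentially"
      using uniform_limit_on_subset[OF unif] by blast
    then show "\<exists>d>0. cball x d \<subseteq> UNIV \<and> uniform_limit (cball x d) g h sequentially"
      by (intro exI[of _ 1]) auto
  qed (use hol in auto)
  moreover have "near (e n) (g n) h" for n
    unfolding near_def
  proof (intro allI impI)
    fix z :: complex assume z: "norm z * e n \<le> 1"
    have "(\<lambda>k. g (n + k) z) \<longlonglongrightarrow> h z"
      using LIMSEQ_ignore_initial_segment[OF tendsto_uniform_limitI[OF unif[of "norm z"]], of z n]
      by (simp add: add.commute)
    then have "(\<lambda>k. norm (g (n + k) z - g n z)) \<longlonglongrightarrow> norm (h z - g n z)"
      by (intro tendsto_intros)
    moreover have "norm (g (n + k) z - g n z) \<le> e n / 2" for k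
    proof -
      have "norm z * (e n / 2) \<le> norm z * e n"
        using pos[of n] by (intro mult_left_mono) auto
      then have "norm z * (e n / 2) \<le> 1" using z by linarith
      then show ?thesis
        using tail[of n k] unfolding near_def by (auto intro: less_imp_le)
    qed
    ultimately have "norm (h z - g n z) \<le> e n / 2"
      by (intro LIMSEQ_le_const2) auto
    then show "norm (h z - g n z) < e n"
      using pos[of n] by linarith
  qed
  ultimately show ?thesis using that by blast
qed

text \<open>The nested-ball argument of the Baire category theorem.\<close>

lemma entire_off_boundaries:
  fixes \<O> :: "nat \<Rightarrow> (complex \<Rightarrow> complex) set"
  assumes opn: "\<And>n g. g \<in> \<O> n \<Longrightarrow> g holomorphic_on UNIV \<Longrightarrow>
      eventually (\<lambda>f. f holomorphic_on UNIV \<longrightarrow> f \<in> \<O> n) (compact_nhds g)"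
  obtains g where "g holomorphic_on UNIV"
    "\<And>n. g \<in> \<O> n \<or>
       eventually (\<lambda>f. f holomorphic_on UNIV \<longrightarrow> f \<notin> \<O> n) (compact_nhds g)"
proof -
  define P where "P = (\<lambda>(n::nat) (ge :: (complex \<Rightarrow> complex) \<times> real).
     fst ge holomorphic_on UNIV \<and> 0 < snd ge)"
  \<comment> \<open>The limit is only known to be within \<open>snd he\<close> of the new centre.
    Membership is needed for the limit alone, but avoidance is needed on a whole ball around it,
    hence the factor 2 in the second alternative.\<close>
  define Q where "Q = (\<lambda>n (ge :: (complex \<Rightarrow> complex) \<times> real) he.
     near (snd ge / 4) (fst ge) (fst he) \<and> snd he \<le> snd ge / 8 \<and>
     ((\<forall>f. f holomorphic_on UNIV \<longrightarrow> near (snd he) (fst he) f \<longrightarrow> f \<in> \<O> n) \<or>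
      (\<forall>f. f holomorphic_on UNIV \<longrightarrow> near (2 * snd he) (fst he) f \<longrightarrow> f \<notin> \<O> n)))"
  have "\<exists>s. \<forall>n. P n (s n) \<and> Q n (s n) (s (Suc n))"
  proof (rule dependent_nat_choice)
    show "\<exists>x. P 0 x"
      by (rule exI[of _ "(\<lambda>_. 0, 1)"]) (auto simp: P_def)
  next
    fix ge n assume "P n ge"
    then obtain g e where ge: "ge = (g, e)" "g holomorphic_on UNIV" "0 < e"
      by (cases ge) (auto simp: P_def)
    show "\<exists>y. P (Suc n) y \<and> Q n ge y"
    proof (cases "\<exists>f. f holomorphic_on UNIV \<and> near (e / 4) g f \<and> f \<in> \<O> n")
      case True
      then obtain f where f: "f holomorphic_on UNIV" "near (e / 4) g f" "f \<in> \<O> n" by blast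
      obtain d where "0 < d" "\<And>h. near d f h \<Longrightarrow> h holomorphic_on UNIV \<Longrightarrow> h \<in> \<O> n"
        using opn[OF f(3,1)] unfolding eventually_compact_nhds by blast
      then have "\<forall>h. h holomorphic_on UNIV \<longrightarrow> near (min d (e / 8)) f h \<longrightarrow> h \<in> \<O> n"
        using near_mono[of "min d (e / 8)" f _ d] by auto
      then show ?thesis
        using f ge \<open>0 < d\<close> by (intro exI[of _ "(f, min d (e / 8))"]) (simp add: P_def Q_def)
    next
      \<comment> \<open>The centre stays \<open>g\<close>; with radius \<open>e / 8\<close> the
        doubled ball is exactly the \<open>e / 4\<close> ball known to miss the open set.\<close>
      case False
      then show ?thesis
        using ge by (intro exI[of _ "(g, e / 8)"]) (auto simp: P_def Q_def near_refl)
    qed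
  qed
  then obtain s where s: "\<And>n. P n (s n)" "\<And>n. Q n (s n) (s (Suc n))" by blast
  obtain g where g: "g holomorphic_on UNIV" "\<And>n. near (snd (s n)) (fst (s n)) g"
    by (rule holomorphic_limit_of_near_sequence[of "\<lambda>n. fst (s n)" "\<lambda>n. snd (s n)"])
       (use s in \<open>auto simp: P_def Q_def\<close>)
  have "g \<in> \<O> n \<or> eventually (\<lambda>f. f holomorphic_on UNIV \<longrightarrow> f \<notin> \<O> n) (compact_nhds g)" for n
  proof -
    define h e where "h = fst (s (Suc n))" and "e = snd (s (Suc n))"
    have e: "0 < e" "near e h g"
      using s(1)[of "Suc n"] g(2)[of "Suc n"] by (auto simp: P_def h_def e_def)
    consider "\<forall>f. f holomorphic_on UNIV \<longrightarrow> near e h f \<longrightarrow> f \<in> \<O> n"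
      | "\<forall>f. f holomorphic_on UNIV \<longrightarrow> near (2 * e) h f \<longrightarrow> f \<notin> \<O> n"
      using s(2)[of n] by (auto simp: Q_def h_def e_def)
    then show ?thesis
    proof cases
      case 1
      then show ?thesis using g(1) e by blast
    next
      case 2
      have "near (2 * e) h f" if "near e g f" for f
        using near_triangle[OF e(2) that e(1) e(1)] by simp
      then show ?thesis
        unfolding eventually_compact_nhds using 2 e(1) by blast
    qed
  qed
  with g(1) that show ?thesis by blast
qed

section \<open>The map z + 1/g(z) and its finite orbits\<close>

text \<open>At a zero of \<open>g\<close> the convention \<open>1 / 0 = 0\<close> gives the spurious
  value \<open>z\<close>, so orbits are meaningful only on \<open>pole_free\<close>.\<close>

definition displace :: "(complex \<Rightarrow> complex) \<Rightarrow> complex \<Rightarrow> complex" where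
  "displace g z = z + 1 / g z"

text \<open>The bound on \<open>j\<close> is strict: the point reached at time \<open>k\<close> is
  finite but may itself be a pole.\<close>

definition pole_free :: "(complex \<Rightarrow> complex) \<Rightarrow> nat \<Rightarrow> complex set" where
  "pole_free g k = {z. \<forall>j<k. g ((displace g ^^ j) z) \<noteq> 0}"

lemma pole_free_0 [simp]: "pole_free g 0 = UNIV"
  by (simp add: pole_free_def)

lemma pole_free_Suc: "pole_free g (Suc k) = {z \<in> pole_free g k. g ((displace g ^^ k) z) \<noteq> 0}"
  by (auto simp: pole_free_def less_Suc_eq)

text \<open>Both claims go through one induction, since the next domain is open by continuity of the
  current iterate.\<close>

lemma holomorphic_orbit:
  assumes "g holomorphic_on UNIV"
  shows "open (pole_free g k) \<and> (displace g ^^ k) holomorphic_on pole_free g k"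
proof (induction k)
  case 0
  then show ?case by (simp add: id_def)
next
  case (Suc k)
  have hol: "(\<lambda>z. g ((displace g ^^ k) z)) holomorphic_on pole_free g k"
    using holomorphic_on_compose_gen[of "displace g ^^ k" "pole_free g k" g UNIV] Suc assms
    by (simp add: o_def)
  have "pole_free g (Suc k) = pole_free g k \<inter> (\<lambda>z. g ((displace g ^^ k) z)) -` (- {0})"
    by (auto simp: pole_free_Suc)
  moreover have "open (pole_free g k \<inter> (\<lambda>z. g ((displace g ^^ k) z)) -` (- {0}))"
    using holomorphic_on_imp_continuous_on[OF hol] Suc by (intro continuous_open_preimage) auto
  moreover have "(\<lambda>z. (displace g ^^ k) z + 1 / g ((displace g ^^ k) z))
      holomorphic_on pole_free g (Suc k)"
    using Suc hol by (intro holomorphic_intros) (auto simp: pole_free_Suc elim: holomorphic_on_subset)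
  moreover have "displace g ^^ Suc k = (\<lambda>z. (displace g ^^ k) z + 1 / g ((displace g ^^ k) z))"
    by (auto simp: displace_def)
  ultimately show ?case by simp
qed

lemma holomorphic_pole_indicator:
  assumes "g holomorphic_on UNIV"
  shows "(\<lambda>z. g ((displace g ^^ k) z)) holomorphic_on pole_free g k"
  using holomorphic_on_compose_gen[of "displace g ^^ k" "pole_free g k" g UNIV]
    holomorphic_orbit[OF assms] assms by (simp add: o_def)

lemma entire_eq_zero:
  assumes "g holomorphic_on UNIV" "open U" "U \<noteq> {}" "\<And>z. z \<in> U \<Longrightarrow> g z = 0"
  shows "g z = 0"
proof -
  obtain u where "u \<in> U" using assms by blast
  then show ?thesis
    using analytic_continuation_open[of U UNIV g "\<lambda>_. 0" z] assms by auto
qed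

text \<open>By the open mapping theorem only local constancy must be excluded. If the value were
  \<open>c\<close> on a disc, then \<open>(c - z) * g z = 1\<close> there, hence everywhere by the
  identity theorem, which fails at \<open>z = c\<close>.\<close>

lemma open_image_displace:
  assumes g: "g holomorphic_on UNIV" and W: "open W" "W \<subseteq> pole_free g 1"
  shows "open (displace g ` W)"
proof (subst open_subopen, safe)
  fix w assume w: "w \<in> W"
  then obtain r where r: "0 < r" "ball w r \<subseteq> W"
    using W openE by blast
  have "\<not> displace g constant_on ball w r"
  proof
    assume "displace g constant_on ball w r"
    then obtain c where c: "\<And>z. z \<in> ball w r \<Longrightarrow> displace g z = c"
      unfolding constant_on_def by blast
    have "(c - z) * g z - 1 = 0" if "z \<in> ball w r" for z
    proof -
      have "g z \<noteq> 0" using that r W by (auto simp: pole_free_def)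
      then show ?thesis using c[OF that] by (auto simp: displace_def field_simps)
    qed
    moreover have "(\<lambda>z. (c - z) * g z - 1) holomorphic_on UNIV"
      using g by (intro holomorphic_intros)
    ultimately have "(c - c) * g c - 1 = 0"
      using r(1) entire_eq_zero[of "\<lambda>z. (c - z) * g z - 1" "ball w r" c] by auto
    then show False by simp
  qed
  moreover have "displace g holomorphic_on ball w r"
    using holomorphic_orbit[OF g, of 1] r W holomorphic_on_subset[of "displace g" "pole_free g 1"]
    by simp
  ultimately have "open (displace g ` ball w r)"
    by (intro open_mapping_thm[where S = "ball w r"]) auto
  then show "\<exists>T. open T \<and> displace g w \<in> T \<and> T \<subseteq> displace g ` W"
    using r by (intro exI[of _ "displace g ` ball w r"]) auto
qed

lemma open_image_orbit:
  assumes "g holomorphic_on UNIV" "open W" "W \<subseteq> pole_free g k"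
  shows "open ((displace g ^^ k) ` W)"
  using assms(3)
proof (induction k)
  case 0
  then show ?case using assms by simp
next
  case (Suc k)
  have "open (displace g ` (displace g ^^ k) ` W)"
  proof (intro open_image_displace[OF assms(1)])
    show "open ((displace g ^^ k) ` W)" "(displace g ^^ k) ` W \<subseteq> pole_free g 1"
      using Suc by (auto simp: pole_free_Suc)
  qed
  then show ?case by (simp add: image_comp)
qed

section \<open>Continuous dependence of orbits on the function\<close>

text \<open>Function and argument vary together. The moving arguments stay in a fixed disc, where
  \<open>f\<close> is uniformly close to \<open>g\<close> and \<open>g\<close> is uniformly
  continuous; each effect contributes \<open>e / 2\<close>.\<close>

lemma uniform_limit_eval:
  assumes g: "continuous_on UNIV g" and K: "compact K" and \<phi>: "continuous_on K \<phi>"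
    and lim: "uniform_limit K \<Phi> \<phi> (compact_nhds g)"
  shows "uniform_limit K (\<lambda>f z. f (\<Phi> f z)) (\<lambda>z. g (\<phi> z)) (compact_nhds g)"
proof (rule uniform_limitI)
  fix e :: real assume e: "0 < e"
  have "bounded (\<phi> ` K)"
    using compact_continuous_image[OF \<phi> K] compact_imp_bounded by blast
  then obtain B where B: "\<And>z. z \<in> K \<Longrightarrow> norm (\<phi> z) \<le> B"
    unfolding bounded_iff by auto
  have "\<forall>\<^sub>F f in compact_nhds g. \<forall>z\<in>K. dist (\<Phi> f z) (\<phi> z) < 1"
    using uniform_limitD[OF lim, of 1] by simp
  then have maps: "\<forall>\<^sub>F f in compact_nhds g. \<Phi> f ` K \<subseteq> cball 0 (B + 1)"
  proof eventually_elim
    case (elim f)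
    have "norm (\<Phi> f z) \<le> B + 1" if "z \<in> K" for z
      using elim[rule_format, OF that] B[OF that] norm_triangle_ineq2[of "\<Phi> f z" "\<phi> z"]
      by (auto simp: dist_norm)
    then show ?case by auto
  qed
  have "uniform_limit K (\<lambda>f z. g (\<Phi> f z)) (g \<circ> \<phi>) (compact_nhds g)"
  proof (rule uniform_limit_compose[OF lim _ maps])
    show "uniformly_continuous_on (cball 0 (B + 1)) g"
      by (intro compact_uniformly_continuous continuous_on_subset[OF g]) auto
    show "\<phi> ` K \<subseteq> cball 0 (B + 1)"
      using B by force
  qed
  then have "\<forall>\<^sub>F f in compact_nhds g. \<forall>z\<in>K. dist (g (\<Phi> f z)) (g (\<phi> z)) < e / 2"
    by (drule_tac uniform_limitD[where e = "e / 2"]) (use e in auto)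
  moreover have "\<forall>\<^sub>F f in compact_nhds g. \<forall>u\<in>cball 0 (B + 1). dist (f u) (g u) < e / 2"
    using uniform_limitD[OF uniform_limit_compact_nhds[of "cball 0 (B + 1)" g], of "e / 2"] e
    by simp
  ultimately show "\<forall>\<^sub>F f in compact_nhds g. \<forall>z\<in>K. dist (f (\<Phi> f z)) (g (\<phi> z)) < e"
    using maps
  proof eventually_elim
    case (elim f)
    show ?case
    proof
      fix z assume z: "z \<in> K"
      then have "\<Phi> f z \<in> cball 0 (B + 1)" using elim(3) by blast
      then show "dist (f (\<Phi> f z)) (g (\<phi> z)) < e"
        using elim(1)[rule_format, OF z] elim(2)
          dist_triangle_half_r[of "g (\<Phi> f z)"] by (metis dist_commute)
    qed
  qed
qed

text \<open>On the compact set the next denominator is bounded below by some \<open>b > 0\<close>.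
  This gives convergence of the reciprocals and also keeps the denominators of nearby
  \<open>f\<close> away from zero.\<close>

lemma uniform_limit_orbit:
  assumes g: "g holomorphic_on UNIV" and K: "compact K" "K \<subseteq> pole_free g k"
  shows "uniform_limit K (\<lambda>f. displace f ^^ k) (displace g ^^ k) (compact_nhds g)
    \<and> (\<forall>\<^sub>F f in compact_nhds g. K \<subseteq> pole_free f k)"
  using K(2)
proof (induction k)
  case 0
  then show ?case by (simp add: uniform_limit_const)
next
  case (Suc k)
  let ?h = "\<lambda>z. g ((displace g ^^ k) z)"
  have reg: "K \<subseteq> pole_free g k" and nz: "\<And>z. z \<in> K \<Longrightarrow> ?h z \<noteq> 0"
    using Suc.prems by (auto simp: pole_free_Suc)
  note IH = Suc.IH[OF reg]
  have cont: "continuous_on K (displace g ^^ k)"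
    using holomorphic_orbit[OF g, of k] reg
    by (meson continuous_on_subset holomorphic_on_imp_continuous_on)
  have conth: "continuous_on K ?h"
    using holomorphic_pole_indicator[OF g, of k] reg
    by (meson continuous_on_subset holomorphic_on_imp_continuous_on)
  have lim: "uniform_limit K (\<lambda>f z. f ((displace f ^^ k) z)) ?h (compact_nhds g)"
    using IH by (intro uniform_limit_eval K cont holomorphic_on_imp_continuous_on[OF g]) auto
  obtain b where b: "0 < b" "\<And>z. z \<in> K \<Longrightarrow> b \<le> norm (?h z)"
  proof (cases "K = {}")
    case False
    obtain x where "x \<in> K" "\<And>y. y \<in> K \<Longrightarrow> norm (?h x) \<le> norm (?h y)"
      using continuous_attains_inf[OF K(1) False continuous_on_norm[OF conth]] by blast
    then show ?thesis using that[of "norm (?h x)"] nz by auto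
  qed (use that[of 1] in auto)
  have "uniform_limit K (\<lambda>f z. inverse (f ((displace f ^^ k) z))) (inverse \<circ> ?h) (compact_nhds g)"
    by (rule uniform_lim_inverse[OF lim b(2,1)])
  then have "uniform_limit K (\<lambda>f z. (displace f ^^ k) z + inverse (f ((displace f ^^ k) z)))
      (\<lambda>z. (displace g ^^ k) z + (inverse \<circ> ?h) z) (compact_nhds g)"
    by (intro uniform_limit_add IH[THEN conjunct1])
  moreover have "\<forall>\<^sub>F f in compact_nhds g. K \<subseteq> pole_free f (Suc k)"
  proof -
    have "\<forall>\<^sub>F f in compact_nhds g. \<forall>z\<in>K. dist (f ((displace f ^^ k) z)) (?h z) < b"
      using uniform_limitD[OF lim b(1)] .
    then show ?thesis
      using IH[THEN conjunct2]
    proof eventually_elim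
      case (elim f)
      have "f ((displace f ^^ k) z) \<noteq> 0" if "z \<in> K" for z
        using elim(1)[rule_format, OF that] b(2)[OF that] by auto
      then show ?case using elim(2) by (auto simp: pole_free_Suc)
    qed
  qed
  ultimately show ?case by (simp add: displace_def[abs_def] inverse_eq_divide o_def)
qed

section \<open>Orbits that hit a pole stably\<close>

text \<open>
  The strict inequality on the circle forces a zero by the minimum modulus principle, and unlike
  the mere existence of a zero it visibly survives small perturbations of \<open>g\<close>.
\<close>

definition stably_hitting :: "complex set \<Rightarrow> nat set \<Rightarrow> (complex \<Rightarrow> complex) set" where
  "stably_hitting B K = {g. \<exists>k\<in>K. \<exists>z r. 0 < r \<and> cball z r \<subseteq> B \<inter> pole_free g k \<and>
     (\<forall>w\<in>sphere z r. norm (g ((displace g ^^ k) z)) < norm (g ((displace g ^^ k) w)))}"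

text \<open>Compactness of the circle turns the strict inequality into a gap of at least
  \<open>2 * d\<close>. Changes smaller than \<open>d\<close> at the centre and on the circle cannot
  close it.\<close>

lemma stably_hitting_open:
  assumes g: "g holomorphic_on UNIV" and hit: "g \<in> stably_hitting B K"
  shows "\<forall>\<^sub>F f in compact_nhds g. f \<in> stably_hitting B K"
proof -
  obtain k z r where k: "k \<in> K" and r: "0 < r" "cball z r \<subseteq> B \<inter> pole_free g k"
    and less: "\<And>w. w \<in> sphere z r \<Longrightarrow>
      norm (g ((displace g ^^ k) z)) < norm (g ((displace g ^^ k) w))"
    using hit unfolding stably_hitting_def by blast
  let ?h = "\<lambda>z. g ((displace g ^^ k) z)"
  have cont: "continuous_on (cball z r) ?h"
    using holomorphic_pole_indicator[OF g, of k] r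
    by (meson continuous_on_subset holomorphic_on_imp_continuous_on le_inf_iff)
  have cont': "continuous_on (cball z r) (displace g ^^ k)"
    using holomorphic_orbit[OF g, of k] r
    by (meson continuous_on_subset holomorphic_on_imp_continuous_on le_inf_iff)
  have "sphere z r \<noteq> {}" using r by simp
  moreover have "continuous_on (sphere z r) (\<lambda>w. norm (?h w))"
    by (intro continuous_on_norm continuous_on_subset[OF cont]) auto
  ultimately obtain x where x: "x \<in> sphere z r" "\<And>y. y \<in> sphere z r \<Longrightarrow> norm (?h x) \<le> norm (?h y)"
    using continuous_attains_inf[of "sphere z r" "\<lambda>w. norm (?h w)"] by auto
  define d where "d = (norm (?h x) - norm (?h z)) / 2"
  have d: "0 < d" using less[OF x(1)] by (simp add: d_def)
  have orbit: "uniform_limit (cball z r) (\<lambda>f. displace f ^^ k) (displace g ^^ k) (compact_nhds g)"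
    "\<forall>\<^sub>F f in compact_nhds g. cball z r \<subseteq> pole_free f k"
    using uniform_limit_orbit[OF g, of "cball z r" k] r by auto
  have lim: "uniform_limit (cball z r) (\<lambda>f z. f ((displace f ^^ k) z)) ?h (compact_nhds g)"
    using orbit by (intro uniform_limit_eval cont' holomorphic_on_imp_continuous_on[OF g]) auto
  show ?thesis
    using uniform_limitD[OF lim d] orbit(2)
  proof eventually_elim
    case (elim f)
    let ?hf = "\<lambda>z. f ((displace f ^^ k) z)"
    have "norm (?hf z) < norm (?hf w)" if w: "w \<in> sphere z r" for w
    proof -
      have "dist (?hf z) (?h z) < d" "dist (?hf w) (?h w) < d"
        using elim(1) r(1) w by auto
      moreover have "2 * d \<le> norm (?h w) - norm (?h z)"
        using x(2)[OF w] by (simp add: d_def)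
      moreover have "norm (?hf z) \<le> norm (?h z) + dist (?hf z) (?h z)"
        using norm_triangle_sub[of "?hf z" "?h z"] by (simp add: dist_norm)
      moreover have "norm (?h w) \<le> norm (?hf w) + dist (?hf w) (?h w)"
        using norm_triangle_sub[of "?h w" "?hf w"] by (simp add: dist_norm norm_minus_commute)
      ultimately show ?thesis by linarith
    qed
    then show ?case
      using elim(2) r k unfolding stably_hitting_def by blast
  qed
qed

lemma stably_hittingD:
  assumes g: "g holomorphic_on UNIV" and hit: "g \<in> stably_hitting B K"
  obtains k z where "k \<in> K" "z \<in> B" "z \<in> pole_free g k" "g ((displace g ^^ k) z) = 0"
proof -
  obtain k z r where k: "k \<in> K" and r: "0 < r" "cball z r \<subseteq> B \<inter> pole_free g k"
    and less: "\<And>w. w \<in> sphere z r \<Longrightarrow>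
      norm (g ((displace g ^^ k) z)) < norm (g ((displace g ^^ k) w))"
    using hit unfolding stably_hitting_def by blast
  have hol: "(\<lambda>z. g ((displace g ^^ k) z)) holomorphic_on cball z r"
    using holomorphic_pole_indicator[OF g, of k] r by (auto elim: holomorphic_on_subset)
  obtain u where u: "u \<in> ball z r" "g ((displace g ^^ k) u) = 0"
  proof (rule holomorphic_contract_to_zero)
    show "continuous_on (cball z r) (\<lambda>z. g ((displace g ^^ k) z))"
      by (rule holomorphic_on_imp_continuous_on[OF hol])
    show "(\<lambda>z. g ((displace g ^^ k) z)) holomorphic_on ball z r"
      by (rule holomorphic_on_subset[OF hol]) auto
  qed (use r less in \<open>auto simp: dist_norm\<close>)
  then have "u \<in> cball z r" by auto
  then have "u \<in> B" "u \<in> pole_free g k" using r by auto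
  then show ?thesis using u(2) k that by blast
qed

text \<open>A small circle works once the zero is isolated. Otherwise \<open>g\<close> would vanish
  on the image of a disc under the iterate, which is open, and hence identically, contradicting
  \<open>g s \<noteq> 0\<close>.\<close>

lemma stably_hittingI:
  assumes g: "g holomorphic_on UNIV" "g s \<noteq> 0" and B: "open B"
    and z: "k \<in> K" "z \<in> B" "z \<in> pole_free g k" "g ((displace g ^^ k) z) = 0"
  shows "g \<in> stably_hitting B K"
proof -
  let ?h = "\<lambda>z. g ((displace g ^^ k) z)"
  have "open (B \<inter> pole_free g k)" "z \<in> B \<inter> pole_free g k"
    using B z holomorphic_orbit[OF g(1), of k] by auto
  then obtain R where R: "0 < R" "ball z R \<subseteq> B \<inter> pole_free g k"
    using openE by blast
  have hol: "?h holomorphic_on ball z R"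
    using holomorphic_pole_indicator[OF g(1), of k] R by (auto elim: holomorphic_on_subset)
  have "\<exists>w\<in>ball z R. ?h w \<noteq> 0"
  proof (rule ccontr)
    assume "\<not> ?thesis"
    then have "\<And>u. u \<in> (displace g ^^ k) ` ball z R \<Longrightarrow> g u = 0"
      by blast
    moreover have "open ((displace g ^^ k) ` ball z R)"
      using R by (intro open_image_orbit[OF g(1)]) auto
    moreover have "(displace g ^^ k) ` ball z R \<noteq> {}"
      using R(1) by simp
    ultimately show False
      using entire_eq_zero[OF g(1)] g(2) by metis
  qed
  then obtain w where "w \<in> ball z R" "?h w \<noteq> 0" by blast
  moreover have "z \<in> ball z R" using R(1) by simp
  ultimately obtain r where r: "0 < r" "ball z r \<subseteq> ball z R"
      "\<And>w. w \<in> ball z r - {z} \<Longrightarrow> ?h w \<noteq> 0"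
    using isolated_zeros[OF hol open_ball connected_ball _ z(4)] by blast
  have "cball z (r / 2) \<subseteq> ball z r" using r by (auto simp: cball_subset_ball_iff)
  then have "cball z (r / 2) \<subseteq> B \<inter> pole_free g k" using r R by blast
  moreover have "norm (?h z) < norm (?h w)" if "w \<in> sphere z (r / 2)" for w
    using r(1) r(3)[of w] that z(4) by auto
  moreover have "0 < r / 2" using r(1) by simp
  ultimately show ?thesis
    unfolding stably_hitting_def mem_Collect_eq using z(1) by blast
qed

section \<open>Small perturbations that create poles\<close>

text \<open>The point \<open>a\<close> lies outside the disc of radius \<open>1 / e\<close>. On that
  disc \<open>norm (z / a)\<close> is at most some \<open>q < 1\<close>, so a high power makes the
  correction negligible, while at \<open>a\<close> it cancels \<open>g\<close> completely.\<close>

lemma near_with_prescribed_zero: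
  fixes g :: "complex \<Rightarrow> complex"
  assumes g: "g holomorphic_on UNIV" and S: "finite S" "a \<notin> S" and e: "0 < e" "1 < norm a * e"
  obtains f where "f holomorphic_on UNIV" "f a = 0" "\<And>s. s \<in> S \<Longrightarrow> f s = g s" "near e g f"
proof -
  define p where "p z = (\<Prod>s\<in>S. (z - s) / (a - s))" for z
  have hol: "p holomorphic_on UNIV"
    unfolding p_def using S by (intro holomorphic_intros) auto
  have "p a = 1"
    unfolding p_def using S by (intro prod.neutral) auto
  have "p s = 0" if "s \<in> S" for s
    unfolding p_def using that S by (intro prod_zero) auto
  have "continuous_on (cball 0 (1 / e)) (\<lambda>z. g z * p z)"
    using g hol by (intro holomorphic_on_imp_continuous_on holomorphic_on_mult)
      (auto elim: holomorphic_on_subset)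
  then have "bounded ((\<lambda>z. g z * p z) ` cball 0 (1 / e))"
    by (intro compact_imp_bounded compact_continuous_image) auto
  then obtain M where M: "0 < M" "\<And>z. z \<in> cball 0 (1 / e) \<Longrightarrow> norm (g z * p z) \<le> M"
    unfolding bounded_pos by auto
  define q where "q = 1 / (norm a * e)"
  have q: "0 < q" "q < 1" using e by (auto simp: q_def)
  have a: "a \<noteq> 0" using e by auto
  obtain m where m: "q ^ m < e / M"
    using real_arch_pow_inv[of "e / M" q] q e M by auto
  define f where "f z = g z * (1 - (z / a) ^ m * p z)" for z
  have "f holomorphic_on UNIV"
    unfolding f_def using g hol a by (intro holomorphic_intros) auto
  moreover have "f a = 0" using \<open>p a = 1\<close> a by (simp add: f_def)
  moreover have "f s = g s" if "s \<in> S" for s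
    using \<open>s \<in> S \<Longrightarrow> p s = 0\<close>[OF that] by (simp add: f_def)
  moreover have "near e g f"
    unfolding near_def
  proof (intro allI impI)
    fix z :: complex assume z: "norm z * e \<le> 1"
    have "norm z \<le> 1 / e" using z e by (simp add: field_simps)
    then have "norm (g z * p z) \<le> M" using M by auto
    moreover have "norm (z / a) \<le> q"
      using z e a by (simp add: q_def norm_divide field_simps)
    then have "norm (z / a) ^ m \<le> q ^ m" by (intro power_mono) auto
    ultimately have "norm (z / a) ^ m * norm (g z * p z) \<le> q ^ m * M"
      using q by (intro mult_mono) auto
    also have "\<dots> < e" using m M by (simp add: field_simps)
    also have "norm (z / a) ^ m * norm (g z * p z) = norm (f z - g z)"
    proof -
      have "f z - g z = - ((z / a) ^ m * (g z * p z))" by (simp add: f_def algebra_simps)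
      then show ?thesis by (simp only: norm_minus_cancel norm_mult norm_power)
    qed
    finally show "norm (f z - g z) < e" .
  qed
  ultimately show ?thesis using that by blast
qed

text \<open>
  The perturbation keeps the orbit of \<open>z\<close> up to its first large point and turns that point into a
  zero.
\<close>

lemma unbounded_orbit_in_closure:
  assumes g: "g holomorphic_on UNIV" and B: "open B" "z \<in> B"
    and reg: "\<And>k. z \<in> pole_free g k" and unb: "\<And>R. \<exists>k. R < norm ((displace g ^^ k) z)"
  shows "\<not> (\<forall>\<^sub>F f in compact_nhds g. f holomorphic_on UNIV \<longrightarrow> f \<notin> stably_hitting B UNIV)"
proof
  assume "\<forall>\<^sub>F f in compact_nhds g. f holomorphic_on UNIV \<longrightarrow> f \<notin> stably_hitting B UNIV"
  then obtain e where e: "0 < e"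
    and not_hit: "\<And>f. near e g f \<Longrightarrow> f holomorphic_on UNIV \<Longrightarrow> f \<notin> stably_hitting B UNIV"
    unfolding eventually_compact_nhds by blast
  \<comment> \<open>Exceeding \<open>norm z\<close> forces \<open>k > 0\<close>, so \<open>z\<close>
    itself is not turned into a zero and witnesses that \<open>f\<close> is not identically zero.
    Exceeding \<open>1 / e\<close> puts \<open>a\<close> outside the disc where \<open>f\<close>
    must be close to \<open>g\<close>.\<close>
  define R where "R = max (norm z) (1 / e)"
  \<comment> \<open>Minimality keeps all earlier points within \<open>R\<close>, hence different
    from the point reached at time \<open>k\<close>.\<close>
  define k where "k = (LEAST k. R < norm ((displace g ^^ k) z))"
  have k: "R < norm ((displace g ^^ k) z)"
    using LeastI_ex[OF unb[of R]] unfolding k_def .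
  have below: "norm ((displace g ^^ j) z) \<le> R" if "j < k" for j
    using not_less_Least[of j "\<lambda>k. R < norm ((displace g ^^ k) z)"] that
    unfolding k_def by (simp add: not_less)
  have "0 < k"
    using k by (intro gr0I) (auto simp: R_def)
  define a where "a = (displace g ^^ k) z"
  define S where "S = (\<lambda>j. (displace g ^^ j) z) ` {..<k}"
  have "norm s \<le> R" if "s \<in> S" for s
    using that below by (auto simp: S_def)
  then have "a \<notin> S"
    using k unfolding a_def[symmetric] by fastforce
  moreover have "1 < norm a * e"
    using k e by (auto simp: R_def a_def field_simps)
  moreover have "finite S" by (simp add: S_def)
  ultimately obtain f where f: "f holomorphic_on UNIV" "f a = 0" "near e g f"
    and fS: "\<And>s. s \<in> S \<Longrightarrow> f s = g s"
    using near_with_prescribed_zero[OF g, of S a e] e by metis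
  have f_orbit: "f ((displace g ^^ j) z) = g ((displace g ^^ j) z)" if "j < k" for j
    using fS that by (auto simp: S_def)
  have same: "(displace f ^^ j) z = (displace g ^^ j) z" if "j \<le> k" for j
    using that
  proof (induction j)
    case (Suc j)
    have "displace f u = displace g u" if "f u = g u" for u
      using that by (simp add: displace_def)
    then show ?case using Suc f_orbit[of j] by simp
  qed simp
  have nz: "g ((displace g ^^ j) z) \<noteq> 0" if "j < k" for j
    using reg[of k] that by (auto simp: pole_free_def)
  have "z \<in> pole_free f k"
    using same f_orbit nz by (auto simp: pole_free_def)
  moreover have "f z \<noteq> 0"
    using f_orbit[OF \<open>0 < k\<close>] nz[OF \<open>0 < k\<close>] by simp
  moreover have "f ((displace f ^^ k) z) = 0"
    using same[of k] f(2) by (simp add: a_def)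
  ultimately have "f \<in> stably_hitting B UNIV"
    using B by (intro stably_hittingI[OF f(1)]) auto
  with not_hit f show False by blast
qed

text \<open>With the time set \<open>{0}\<close>, hitting a pole just means that the function has a
  zero in the given set; these zeros later exclude rationality.\<close>

lemma distant_zero_in_closure:
  assumes g: "g holomorphic_on UNIV"
  shows "\<not> (\<forall>\<^sub>F f in compact_nhds g.
    f holomorphic_on UNIV \<longrightarrow> f \<notin> stably_hitting (- cball 0 R) {0})"
proof
  assume "\<forall>\<^sub>F f in compact_nhds g.
    f holomorphic_on UNIV \<longrightarrow> f \<notin> stably_hitting (- cball 0 R) {0}"
  then obtain e where e: "0 < e"
    and not_hit: "\<And>f. near e g f \<Longrightarrow> f holomorphic_on UNIV \<Longrightarrow>
      f \<notin> stably_hitting (- cball 0 R) {0}"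
    unfolding eventually_compact_nhds by blast
  \<comment> \<open>Multiplicative perturbation cannot change the zero function, so that function is
    first replaced by a small nonzero constant.\<close>
  obtain h s where h: "h holomorphic_on UNIV" "near (e / 2) g h" "h s \<noteq> 0"
  proof (cases "\<exists>s. g s \<noteq> 0")
    case True
    then show ?thesis using that g e near_refl[of "e / 2" g] by auto
  next
    case False
    then show ?thesis
      using that[of "\<lambda>_. of_real (e / 4)" 0] e by (auto simp: near_def norm_divide)
  qed
  \<comment> \<open>The summands put \<open>a\<close> beyond \<open>R\<close>, away from
    \<open>s\<close>, and outside the disc of radius \<open>2 / e\<close> tested by
    \<open>near (e / 2)\<close>.\<close>
  define a where "a = complex_of_real (\<bar>R\<bar> + norm s + 2 / e + 1)"
  have norm_a: "norm a = \<bar>R\<bar> + norm s + 2 / e + 1"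
    using e by (simp add: a_def del: of_real_add)
  have "a \<noteq> s" "a \<in> - cball 0 R"
  proof -
    have "0 < 2 / e" using e by simp
    then have "norm s < norm a" "R < norm a" using norm_a norm_ge_zero[of s] by linarith+
    then show "a \<noteq> s" "a \<in> - cball 0 R" by auto
  qed
  moreover have "1 < norm a * (e / 2)"
  proof -
    have "2 / e * (e / 2) < norm a * (e / 2)"
      using e by (intro mult_strict_right_mono) (auto simp: norm_a add_nonneg_pos)
    then show ?thesis using e by simp
  qed
  ultimately obtain f where f: "f holomorphic_on UNIV" "f a = 0" "f s = h s" "near (e / 2) h f"
    using near_with_prescribed_zero[OF h(1), of "{s}" a "e / 2"] e by auto
  have "f \<in> stably_hitting (- cball 0 R) {0}"
    using f h(3) \<open>a \<in> - cball 0 R\<close> by (intro stably_hittingI[of f s _ 0 _ a]) auto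
  moreover have "near e g f"
    using near_triangle[OF h(2) f(4)] e by simp
  ultimately show False using not_hit f(1) by blast
qed

section \<open>The map into the Riemann sphere\<close>

definition displace_map :: "(complex \<Rightarrow> complex) \<Rightarrow> complex \<Rightarrow> riemann_sphere" where
  "displace_map g z = (if g z = 0 then None else Some (displace g z))"

lemma displace_map_no_fixpoint: "displace_map g z \<noteq> Some z"
  by (simp add: displace_map_def displace_def)

text \<open>The zeros of \<open>g\<close> are isolated because \<open>g s \<noteq> 0\<close>. They
  are precisely the poles, and there \<open>finite_part\<close> supplies the value 0 that nice
  meromorphy demands.\<close>

lemma meromorphic_map_displace_map:
  assumes g: "g holomorphic_on UNIV" and nz: "g s \<noteq> 0"
  shows "meromorphic_map (displace_map g)"
proof -
  let ?F = "finite_part (displace_map g)"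
  have F: "?F z = (if g z = 0 then 0 else z + 1 / g z)" for z
    by (simp add: finite_part_def displace_map_def displace_def)
  have g_cont: "continuous_on UNIV g"
    by (rule holomorphic_on_imp_continuous_on[OF g])
  have opn: "open {z. g z \<noteq> 0}"
    using open_Collect_neq[OF g_cont continuous_on_const] .
  have isolated: "\<forall>\<^sub>F w in at z. g w \<noteq> 0" for z
    using non_zero_neighbour_alt[OF g, of z s] nz by (auto elim: eventually_mono)
  have pole: "is_pole ?F z" if "g z = 0" for z
  proof -
    have "isCont g z" using g_cont by (simp add: continuous_on_eq_continuous_at)
    then have "filterlim g (at 0) (at z)"
      using isolated[of z] that by (auto simp: filterlim_at isCont_def)
    \<comment> \<open>Over the common denominator \<open>g w\<close> the numerator equals 1 at
      \<open>z\<close>, so nothing cancels.\<close>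
    then have "is_pole (\<lambda>w. (w * g w + 1) / g w) z"
      using that \<open>isCont g z\<close> by (intro is_pole_divide) (auto intro!: continuous_intros)
    moreover have "\<forall>\<^sub>F w in at z. (w * g w + 1) / g w = ?F w"
      using isolated[of z] by eventually_elim (auto simp: F field_simps)
    ultimately show ?thesis
      using is_pole_cong[of "\<lambda>w. (w * g w + 1) / g w" ?F z z] by blast
  qed
  have ana: "?F analytic_on {z. g z \<noteq> 0}"
  proof -
    have "(\<lambda>z. z + 1 / g z) holomorphic_on {z. g z \<noteq> 0}"
      using holomorphic_on_subset[OF g, of "{z. g z \<noteq> 0}"] by (intro holomorphic_intros) auto
    then have "?F holomorphic_on {z. g z \<noteq> 0}"
      by (rule holomorphic_transform) (simp add: F)
    then show ?thesis using opn by (simp add: analytic_on_open)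
  qed
  have not_pole: "\<not> is_pole ?F z" "isCont ?F z" if "g z \<noteq> 0" for z
  proof -
    have "?F analytic_on {z}"
      using ana by (rule analytic_on_subset) (use that in auto)
    then show "\<not> is_pole ?F z" "isCont ?F z"
      using analytic_at_imp_no_pole analytic_at_imp_isCont by blast+
  qed
  have "?F meromorphic_on UNIV"
  proof -
    have "(\<lambda>z. z + 1 / g z) meromorphic_on UNIV"
      using g by (intro meromorphic_intros analytic_on_imp_meromorphic_on)
        (auto simp: analytic_on_open)
    moreover have "\<forall>\<^sub>F w in at z. w + 1 / g w = ?F w" for z
      using isolated[of z] by eventually_elim (simp add: F)
    ultimately show ?thesis
      using meromorphic_on_cong[of UNIV "\<lambda>z. z + 1 / g z" ?F UNIV] by auto
  qed
  then have "?F nicely_meromorphic_on UNIV"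
    unfolding nicely_meromorphic_on_def
    using pole not_pole by (metis F UNIV_I isCont_def)
  moreover have "displace_map g z = None \<longleftrightarrow> is_pole ?F z" for z
    using pole not_pole by (auto simp: displace_map_def)
  ultimately show ?thesis
    unfolding meromorphic_map_def by blast
qed

text \<open>A rational map can be infinite only at the finitely many zeros of its denominator, so
  the zeros of \<open>g\<close> would be bounded.\<close>

lemma displace_map_not_rational:
  assumes "\<And>R. \<exists>z. R < norm z \<and> g z = 0"
  shows "\<not> rational_map (displace_map g)"
proof
  assume "rational_map (displace_map g)"
  then obtain p q where q: "q \<noteq> 0"
    and F: "\<And>z. poly q z \<noteq> 0 \<Longrightarrow> displace_map g z = Some (poly p z / poly q z)"
    unfolding rational_map_def by blast
  have "{z. g z = 0} \<subseteq> {z. poly q z = 0}"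
    using F by (force simp: displace_map_def)
  then have "bounded {z. g z = 0}"
    using poly_roots_finite[OF q] finite_imp_bounded finite_subset by blast
  then obtain R where "\<And>z. g z = 0 \<Longrightarrow> norm z \<le> R"
    unfolding bounded_iff by auto
  then show False using assms[of R] by force
qed

lemma iterate_displace_map:
  "z \<in> pole_free g k \<Longrightarrow> iterate (displace_map g) k z = Some ((displace g ^^ k) z)"
  by (induction k) (auto simp: pole_free_Suc displace_map_def)

lemma pole_free_if_iterates_finite:
  assumes "\<And>k. iterate (displace_map g) k z \<noteq> None"
  shows "z \<in> pole_free g k"
proof (induction k)
  case (Suc k)
  then show ?case
    using assms[of "Suc k"] iterate_displace_map[OF Suc] by (auto simp: pole_free_Suc displace_map_def)
qed simp

section \<open>The Fatou set and escape to infinity\<close>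

lemma open_fatou_set: "open (fatou_set F)"
proof (subst open_subopen, safe)
  fix z assume "z \<in> fatou_set F"
  then obtain U where U: "open U" "z \<in> U" "\<forall>k. \<forall>w\<in>U. iterate_defined F k w"
    "normal_family_on U (range (iterate F))"
    unfolding fatou_set_def by blast
  then have "U \<subseteq> fatou_set F" unfolding fatou_set_def by blast
  with U show "\<exists>T. open T \<and> z \<in> T \<and> T \<subseteq> fatou_set F" by blast
qed

lemma iterate_finite_on_fatou_set: "z \<in> fatou_set F \<Longrightarrow> iterate F k z \<noteq> None"
  unfolding fatou_set_def iterate_defined_def by blast

text \<open>The cosine of the spherical distance to infinity is the height
  \<open>1 - 2 / ((norm (x k))\<^sup>2 + 1)\<close> on the unit sphere. For a bounded sequence it
  stays below a constant less than 1.\<close>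

lemma spherical_limit_infinity_unbounded:
  assumes "(\<lambda>k. spherical_dist (Some (x k)) None) \<longlonglongrightarrow> 0"
  shows "\<exists>k. R < norm (x k)"
proof (rule ccontr)
  assume "\<not> ?thesis"
  then have le: "norm (x k) \<le> R" for k by (auto simp: not_less)
  define c where "c k = 1 - 2 / ((norm (x k))\<^sup>2 + 1)" for k
  have pos: "0 < (norm (x k))\<^sup>2 + 1" for k
    by (simp add: add_nonneg_pos)
  have "to_unit_sphere (Some (x k)) \<bullet> to_unit_sphere None = c k" for k
    using pos[of k] by (simp add: inner_prod_def c_def field_simps)
  then have dist: "spherical_dist (Some (x k)) None = arccos (c k)" for k
    by (simp add: spherical_dist_def)
  have "-1 \<le> c k" "c k \<le> 1" for k
    using pos[of k] by (auto simp: c_def field_simps)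
  then have "cos (spherical_dist (Some (x k)) None) = c k" for k
    by (simp add: dist cos_arccos)
  moreover have "(\<lambda>k. cos (spherical_dist (Some (x k)) None)) \<longlonglongrightarrow> cos 0"
    using assms by (intro tendsto_cos)
  ultimately have "c \<longlonglongrightarrow> 1" by simp
  moreover have "c k \<le> 1 - 2 / (R\<^sup>2 + 1)" for k
  proof -
    have "(norm (x k))\<^sup>2 \<le> R\<^sup>2" using le[of k] by (intro power_mono) auto
    then show ?thesis
      using pos[of k] unfolding c_def by (intro diff_left_mono divide_left_mono mult_pos_pos) auto
  qed
  ultimately have "1 \<le> 1 - 2 / (R\<^sup>2 + 1)"
    by (intro LIMSEQ_le_const2) auto
  moreover have "0 < 2 / (R\<^sup>2 + 1)" by (simp add: add_nonneg_pos)
  ultimately show False by linarith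
qed

section \<open>Choice of a generic function\<close>

theorem mainTheorem3:
  shows "\<exists>F :: complex \<Rightarrow> riemann_sphere.
           transcendental_meromorphic F \<and>
           \<not> (\<exists>z. F z = Some z) \<and>
           \<not> (\<exists>U. invariant_baker_domain F U)"
proof -
  obtain \<B> :: "complex set set" where \<B>: "countable \<B>" "topological_basis \<B>"
    using ex_countable_basis by blast
  \<comment> \<open>Even indices enumerate the basis, odd indices ask for zeros outside arbitrarily
    large discs.\<close>
  define \<O> where "\<O> n = (if even n then stably_hitting (from_nat_into \<B> (n div 2)) UNIV
    else stably_hitting (- cball 0 (real n)) {0})" for n
  obtain g where g: "g holomorphic_on UNIV" and generic: "\<And>n. g \<in> \<O> n \<or>
       eventually (\<lambda>f. f holomorphic_on UNIV \<longrightarrow> f \<notin> \<O> n) (compact_nhds g)"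
  proof (rule entire_off_boundaries[of \<O>])
    fix n f assume "f \<in> \<O> n" "f holomorphic_on UNIV"
    then have "\<forall>\<^sub>F h in compact_nhds f. h \<in> \<O> n"
      unfolding \<O>_def by (cases "even n") (simp_all add: stably_hitting_open)
    then show "\<forall>\<^sub>F h in compact_nhds f. h holomorphic_on UNIV \<longrightarrow> h \<in> \<O> n"
      by eventually_elim simp
  qed blast
  have zeros: "\<exists>z. R < norm z \<and> g z = 0" for R
  proof -
    obtain n :: nat where n: "R \<le> real n" using real_arch_simple by blast
    \<comment> \<open>Being in the closure rules out the second alternative of
      \<open>generic\<close>, so \<open>g\<close> is in the open set itself.\<close>
    have "g \<in> stably_hitting (- cball 0 (real (2 * n + 1))) {0}"
      using generic[of "2 * n + 1"] distant_zero_in_closure[OF g] by (simp add: \<O>_def)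
    then obtain k z where "k \<in> {0}" "z \<in> - cball 0 (real (2 * n + 1))"
        "g ((displace g ^^ k) z) = 0"
      by (rule stably_hittingD[OF g])
    then have "g z = 0" "R < norm z" using n by auto
    then show ?thesis by blast
  qed
  have hit: "g \<in> stably_hitting B UNIV"
    if "B \<in> \<B>" "open B" "z \<in> B" "\<And>k. z \<in> pole_free g k"
      "\<And>R. \<exists>k. R < norm ((displace g ^^ k) z)" for B z
  proof -
    obtain n where n: "from_nat_into \<B> n = B"
      using from_nat_into_surj[OF \<B>(1) \<open>B \<in> \<B>\<close>] by blast
    show ?thesis
      using generic[of "2 * n"] unbounded_orbit_in_closure[OF g that(2,3,4,5)] by (simp add: \<O>_def n)
  qed
  \<comment> \<open>Distant zeros alone are compatible with \<open>g = 0\<close>; the strict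
    inequality on a circle is not.\<close>
  have "\<exists>s. g s \<noteq> 0"
  proof (rule ccontr)
    assume "\<not> ?thesis"
    then have zero: "g z = 0" for z by simp
    have "g \<in> stably_hitting (- cball 0 (real 1)) {0}"
      using generic[of 1] distant_zero_in_closure[OF g, of 1] by (simp add: \<O>_def)
    then obtain z r where "0 < r" "\<forall>w\<in>sphere z r. norm (g z) < norm (g w)"
      unfolding stably_hitting_def by auto
    moreover from this have "z + of_real r \<in> sphere z r"
      by (simp add: dist_norm)
    ultimately show False
      using zero by (metis less_irrefl)
  qed
  then obtain s where s: "g s \<noteq> 0" by blast
  have "\<not> invariant_baker_domain (displace_map g) U" for U
  proof
    assume U: "invariant_baker_domain (displace_map g) U"
    then have comp: "U \<in> components (fatou_set (displace_map g))"
      by (simp add: invariant_baker_domain_def invariant_component_def)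
    have "open U" using open_components[OF open_fatou_set comp] .
    moreover obtain z where "z \<in> U" using in_components_nonempty[OF comp] by blast
    \<comment> \<open>Genericity controls only the countably many basis sets, so \<open>U\<close> is
      replaced by one of them inside it.\<close>
    ultimately obtain B where B: "B \<in> \<B>" "z \<in> B" "B \<subseteq> U"
      using topological_basisE[OF \<B>(2)] by blast
    have reg: "w \<in> pole_free g k" if "w \<in> U" for w k
      using pole_free_if_iterates_finite iterate_finite_on_fatou_set
        in_components_subset[OF comp] that by blast
    have "(\<lambda>k. spherical_dist (iterate (displace_map g) k z) None) \<longlonglongrightarrow> 0"
      using U \<open>z \<in> U\<close> by (simp add: invariant_baker_domain_def)
    then have "(\<lambda>k. spherical_dist (Some ((displace g ^^ k) z)) None) \<longlonglongrightarrow> 0"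
      using iterate_displace_map[OF reg[OF \<open>z \<in> U\<close>]] by simp
    then have unb: "\<exists>k. R < norm ((displace g ^^ k) z)" for R
      by (rule spherical_limit_infinity_unbounded)
    have "g \<in> stably_hitting B UNIV"
      by (rule hit[OF B(1) topological_basis_open[OF \<B>(2) B(1)] B(2) reg[OF \<open>z \<in> U\<close>] unb])
    then obtain k w where "w \<in> B" "g ((displace g ^^ k) w) = 0"
      by (rule stably_hittingD[OF g])
    \<comment> \<open>A zero at time \<open>k\<close> is excluded by
      \<open>pole_free g (Suc k)\<close>, hence the successor.\<close>
    then show False
      using reg[of w "Suc k"] B(3) by (auto simp: pole_free_Suc)
  qed
  moreover have "transcendental_meromorphic (displace_map g)"
    using meromorphic_map_displace_map[OF g s] displace_map_not_rational[OF zeros]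
    by (simp add: transcendental_meromorphic_def)
  ultimately show ?thesis
    using displace_map_no_fixpoint by blast
qed

end
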